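(* Let $n\ge L\ge 2$ and $s\ge 0$ be integers. If a string $\mathbf{x}\in\{0,1\}^n$ is $(L-1,4s+1)$-substring distant, then it is $(L,t,s)$-reconstructible for every $t\in\{1,\dots,n\}$: for every $(t,s)$-erroneous $L$-multispectrum $U$ of $\mathbf{x}$, the string $\mathbf{W}_2(U)$ can be uniquely reconstructed from the (unordered) multiset $U$. Explicitly, there is a map $\mathrm{Rec}$ (depending only on $n,L,s$) from multisets of strings in $\{0,1\}^L$ to $\{0,1\}^n$ such that for every $(L-1,4s+1)$-substring distant $\mathbf{x}\in\{0,1\}^n$, every $t\in\{1,\dots,n\}$ and every $U\in\mathcal{B}_{L,t,s}(\mathbf{x})$, $\mathrm{Rec}(U)=\mathbf{W}_2(U)$.
   Context: $\Sigma=\{0,1\}$, $[i]=\{1,\dots,i\}$. For $\mathbf{w}\in\Sigma^n$, $\mathbf{w}_{i,k}=(w_i,\dots,w_{i+k-1})$. $d_H$ is Hamming distance. A string $\mathbf{w}\in\Sigma^n$ is $(\ell,d)$-substring distant if $d_H(\mathbf{w}_{i,\ell},\mathbf{w}_{j,\ell})\ge d$ for all $1\le i<j\le n-\ell+1$. A multiset $U=\{\mathbf{u}_1,\dots,\mathbf{u}_{n-L+1}\}$ of strings in $\Sigma^L$ is a $(t,s)$-erroneous $L$-multispectrum of $\mathbf{w}\in\Sigma^n$ if there is a set $I_e(U)\subseteq[n-L+1]$ of at most $t$ indices such that $\mathbf{u}_i=\mathbf{w}_{i,L}$ for $i\in[n-L+1]\setminus I_e(U)$ and $d_H(\mathbf{u}_i,\mathbf{w}_{i,L})\le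 s$ for $i\in I_e(U)$. $\mathcal{B}_{L,t,s}(\mathbf{w})$ is the collection of all such $U$. The decoder receives $U$ as an unordered multiset (the indexing is not given). For a multiset $A$ over $\Sigma$, $\mathrm{maj}(A)$ is the element with the most appearances in $A$, ties being broken in favour of the lexicographically first element. Let the elements of $U\in\mathcal{B}_{L,t,s}(\mathbf{w})$ be indexed $\mathbf{u}_1,\dots,\mathbf{u}_{n-L+1}$ relative to $\mathbf{w}$, i.e. so that $\mathbf{u}_i=\mathbf{w}_{i,L}$ for all $i\in[n-L+1]$ outside a set of at most $t$ indices, and $d_H(\mathbf{u}_i,\mathbf{w}_{i,L})\le s$ for the indices $i$ in that set. With this indexing, $\mathbf{W}_2(U)=(w_1',\dots,w_n')$ where $$w_j'=\mathrm{maj}\{(\mathbf{u}_i)_k \mid i\in[n-L+1],\ k\in[L],\ i+k-1=j\}.$$ *)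

theory Defs
  imports Main "HOL-Library.Multiset"
begin

text \<open>
  Binary strings are lists of booleans, with \<open>False\<close> for 0 and \<open>True\<close> for 1; the set
  \<open>\<Sigma>\<^sup>n\<close> is the set of lists of length \<open>n\<close>. Positions are counted from 1, so the
  \<open>i\<close>-th symbol of \<open>w\<close> is \<open>w ! (i - 1)\<close>.
\<close>

definition substr :: "'a list \<Rightarrow> nat \<Rightarrow> nat \<Rightarrow> 'a list" where
  "substr w i k = take k (drop (i - 1) w)"

text \<open>Only meaningful for lists of equal length.\<close>

definition hamming_dist :: "'a list \<Rightarrow> 'a list \<Rightarrow> nat" where
  "hamming_dist u v = card {i. i < length u \<and> u ! i \<noteq> v ! i}"

definition substring_distant :: "nat \<Rightarrow> nat \<Rightarrow> bool list \<Rightarrow> bool" where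
  "substring_distant l d w \<longleftrightarrow>
     (\<forall>i j. 1 \<le> i \<and> i < j \<and> j \<le> length w - l + 1 \<longrightarrow>
        hamming_dist (substr w i l) (substr w j l) \<ge> d)"

text \<open>
  \<open>indexed_relative L t s w U u\<close>: the family \<open>u 1, \<dots>, u (n - L + 1)\<close> with \<open>n = length w\<close>
  enumerates the multiset \<open>U\<close> with multiplicity, and at most \<open>t\<close> of its members differ from
  the corresponding length-\<open>L\<close> substrings of \<open>w\<close>, each in at most \<open>s\<close> positions.
  The values of \<open>u\<close> outside \<open>{1..n - L + 1}\<close> are irrelevant.
\<close>

definition indexed_relative ::
  "nat \<Rightarrow> nat \<Rightarrow> nat \<Rightarrow> bool list \<Rightarrow> bool list multiset \<Rightarrow> (nat \<Rightarrow> bool list) \<Rightarrow> bool" where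
  "indexed_relative L t s w U u \<longleftrightarrow>
     (\<forall>i\<in>{1..length w - L + 1}. length (u i) = L) \<and>
     U = {# u i. i \<in># mset_set {1..length w - L + 1} #} \<and>
     (\<exists>I \<subseteq> {1..length w - L + 1}. card I \<le> t \<and>
        (\<forall>i\<in>{1..length w - L + 1} - I. u i = substr w i L) \<and>
        (\<forall>i\<in>I. hamming_dist (u i) (substr w i L) \<le> s))"

definition erroneous_multispectra ::
  "nat \<Rightarrow> nat \<Rightarrow> nat \<Rightarrow> bool list \<Rightarrow> bool list multiset set" where
  "erroneous_multispectra L t s w = {U. \<exists>u. indexed_relative L t s w U u}"

text \<open>The linear order on symbols breaks ties; on \<open>bool\<close> it is \<open>False < True\<close>.\<close>

definition maj :: "'a::linorder multiset \<Rightarrow> 'a" where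
  "maj A = Min {a \<in> set_mset A. \<forall>b. count A b \<le> count A a}"

text \<open>
  The string \<open>W\<^sub>2(U)\<close>, as a function of the indexing \<open>u\<close> of \<open>U\<close>, which \<open>U\<close> alone does not
  supply.
\<close>

definition W2 :: "nat \<Rightarrow> nat \<Rightarrow> (nat \<Rightarrow> bool list) \<Rightarrow> bool list" where
  "W2 n L u =
     map (\<lambda>j. maj {# u i ! (k - 1).
                 (i, k) \<in># mset_set {(i, k) \<in> {1..n - L + 1} \<times> {1..L}. i + k - 1 = j} #})
       [1..<n + 1]"

end

theory Submission
  imports Defs
begin

text \<open>
  Write \<open>m = n - L + 1\<close>. The suffix of length \<open>L - 1\<close> of \<open>u i\<close> and the prefix of length
  \<open>L - 1\<close> of \<open>u j\<close> are within distance \<open>s\<close> of the substrings of \<open>x\<close> at positions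
  \<open>i + 1\<close> and \<open>j\<close>. So their distance is at most \<open>2s\<close> if \<open>j = i + 1\<close>, and at least
  \<open>(4s + 1) - 2s\<close> otherwise. The relation ``the suffix of \<open>v\<close> is within \<open>2s\<close> of the prefix
  of \<open>w\<close>'', which does not mention \<open>x\<close>, thus makes \<open>U\<close> a directed path. Its unique source
  is \<open>u 1\<close>, and following the arrows recovers the whole indexing, hence \<open>W\<^sub>2(U)\<close>.
\<close>

lemma hamming_dist_refl [simp]: "hamming_dist u u = 0"
  by (simp add: hamming_dist_def)

lemma hamming_dist_commute:
  "length u = length v \<Longrightarrow> hamming_dist u v = hamming_dist v u"
  unfolding hamming_dist_def by (rule arg_cong[where f = card]) auto

lemma hamming_dist_triangle:
  assumes "length u = length v"
  shows "hamming_dist u w \<le> hamming_dist u v + hamming_dist v w"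
proof -
  have "hamming_dist u w
      \<le> card ({i. i < length u \<and> u ! i \<noteq> v ! i} \<union> {i. i < length v \<and> v ! i \<noteq> w ! i})"
    unfolding hamming_dist_def using assms by (intro card_mono) auto
  also have "\<dots> \<le> hamming_dist u v + hamming_dist v w"
    unfolding hamming_dist_def by (rule card_Un_le)
  finally show ?thesis .
qed

lemma hamming_dist_butlast_le:
  assumes "length u = length v"
  shows "hamming_dist (butlast u) (butlast v) \<le> hamming_dist u v"
  unfolding hamming_dist_def using assms by (intro card_mono) (auto simp: nth_butlast)

lemma hamming_dist_tl_le:
  assumes "length u = length v"
  shows "hamming_dist (tl u) (tl v) \<le> hamming_dist u v"
  unfolding hamming_dist_def using assms
  by (intro card_inj_on_le[where f = Suc]) (auto simp: nth_tl)

lemma length_substr: "1 \<le> i \<Longrightarrow> i + k \<le> length w + 1 \<Longrightarrow> length (substr w i k) = k"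
  by (simp add: substr_def)

lemma butlast_substr:
  "1 \<le> i \<Longrightarrow> i + k \<le> length w + 1 \<Longrightarrow> butlast (substr w i k) = substr w i (k - 1)"
  by (simp add: substr_def butlast_take)

lemma tl_substr: "1 \<le> i \<Longrightarrow> tl (substr w i k) = substr w (i + 1) (k - 1)"
  by (cases i; cases k) (simp_all add: substr_def tl_take drop_Suc flip: drop_tl)

lemma substring_distantD:
  assumes "substring_distant l d w" "1 \<le> i" "1 \<le> j" "i \<noteq> j"
    and "i + l \<le> length w + 1" "j + l \<le> length w + 1"
  shows "d \<le> hamming_dist (substr w i l) (substr w j l)"
proof (cases "i < j")
  case True
  then show ?thesis
    using assms unfolding substring_distant_def by auto
next
  case False
  with assms have "d \<le> hamming_dist (substr w j l) (substr w i l)"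
    unfolding substring_distant_def by auto
  also have "\<dots> = hamming_dist (substr w i l) (substr w j l)"
    using assms by (intro hamming_dist_commute) (simp add: length_substr)
  finally show ?thesis .
qed

text \<open>Error-free reads are at distance 0, so one bound \<open>s\<close> covers all reads and
  the error set need not be carried further.\<close>

lemma indexed_relative_hamming_dist_le:
  assumes "indexed_relative L t s w U u" "i \<in> {1..length w - L + 1}"
  shows "length (u i) = L" "hamming_dist (u i) (substr w i L) \<le> s"
proof -
  show "length (u i) = L"
    using assms by (simp add: indexed_relative_def)
  obtain I where I: "\<forall>i\<in>{1..length w - L + 1} - I. u i = substr w i L"
      "\<forall>i\<in>I. hamming_dist (u i) (substr w i L) \<le> s"
    using assms(1) unfolding indexed_relative_def by blast
  show "hamming_dist (u i) (substr w i L) \<le> s"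
  proof (cases "i \<in> I")
    case False
    with I(1) assms(2) have "u i = substr w i L" by blast
    then show ?thesis by simp
  qed (use I(2) in blast)
qed

lemma indexed_relative_set_mset:
  "indexed_relative L t s w U u \<Longrightarrow> set_mset U = u ` {1..length w - L + 1}"
  by (auto simp: indexed_relative_def)

lemma overlap_iff_consecutive:
  assumes "1 \<le> L" "L \<le> length x" "substring_distant (L - 1) (4 * s + 1) x"
    and u: "indexed_relative L t s x U u"
    and i: "i \<in> {1..length x - L + 1}" and j: "j \<in> {1..length x - L + 1}"
  shows "hamming_dist (tl (u i)) (butlast (u j)) \<le> 2 * s \<longleftrightarrow> j = Suc i"
proof -
  let ?a = "substr x (Suc i) (L - 1)" and ?b = "substr x j (L - 1)"
  let ?v = "tl (u i)" and ?w = "butlast (u j)"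
  have pos: "1 \<le> i" "i + L \<le> length x + 1" "1 \<le> j" "j + L \<le> length x + 1"
    using i j \<open>L \<le> length x\<close> by auto
  \<comment> \<open>For the last read, \<open>Suc i\<close> is one past the final window of length
    \<open>L\<close>, but still starts a window of length \<open>L - 1\<close>. Hence distance from
    every prefix is also guaranteed there, and the last read has no successor.\<close>
  then have pos': "Suc i + (L - 1) \<le> length x + 1" "j + (L - 1) \<le> length x + 1"
    using \<open>1 \<le> L\<close> by auto
  have len: "length (u i) = L" "length (u j) = L"
      "length (substr x i L) = L" "length (substr x j L) = L"
    using indexed_relative_hamming_dist_le(1)[OF u] i j pos by (simp_all add: length_substr)
  have lens: "length ?v = L - 1" "length ?w = L - 1" "length ?a = L - 1" "length ?b = L - 1"
    using len pos pos' by (simp_all add: length_substr)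
  have "hamming_dist ?v (tl (substr x i L)) \<le> s"
    using hamming_dist_tl_le[of "u i" "substr x i L"] len
      indexed_relative_hamming_dist_le(2)[OF u i] by linarith
  then have va: "hamming_dist ?v ?a \<le> s"
    using pos by (simp add: tl_substr)
  have "hamming_dist ?w (butlast (substr x j L)) \<le> s"
    using hamming_dist_butlast_le[of "u j" "substr x j L"] len
      indexed_relative_hamming_dist_le(2)[OF u j] by linarith
  then have wb: "hamming_dist ?w ?b \<le> s"
    using pos by (simp add: butlast_substr)
  have av: "hamming_dist ?a ?v \<le> s" and bw: "hamming_dist ?b ?w \<le> s"
    using va wb lens hamming_dist_commute[of ?v ?a] hamming_dist_commute[of ?w ?b] by simp_all
  show ?thesis
  proof
    assume "j = Suc i"
    then show "hamming_dist ?v ?w \<le> 2 * s"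
      using hamming_dist_triangle[of ?v ?a ?w] va bw lens by simp
  next
    assume le: "hamming_dist ?v ?w \<le> 2 * s"
    show "j = Suc i"
    proof (rule ccontr)
      assume "j \<noteq> Suc i"
      then have "4 * s + 1 \<le> hamming_dist ?a ?b"
        using pos pos' by (intro substring_distantD[OF assms(3)]) auto
      \<comment> \<open>The three legs add up to at most \<open>s + 2 * s + s\<close>, one short of
        the guaranteed \<open>4 * s + 1\<close>.\<close>
      moreover have "hamming_dist ?a ?b
          \<le> hamming_dist ?a ?v + (hamming_dist ?v ?w + hamming_dist ?w ?b)"
        using hamming_dist_triangle[of ?a ?v ?b] hamming_dist_triangle[of ?v ?w ?b] lens
        by linarith
      ultimately show False
        using le av wb by linarith
    qed
  qed
qed

text \<open>A finite directed path has a single source and each vertex at most one successor, so its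
  vertices can be listed in only one way. Equal images suffice, since \<open>R\<close> already
  forces both enumerations to be injective.\<close>

lemma path_enumeration_unique:
  fixes u v :: "nat \<Rightarrow> 'a"
  assumes img: "u ` {1..m} = v ` {1..m}"
    and u: "\<And>i j. i \<in> {1..m} \<Longrightarrow> j \<in> {1..m} \<Longrightarrow> R (u i) (u j) \<longleftrightarrow> j = Suc i"
    and v: "\<And>i j. i \<in> {1..m} \<Longrightarrow> j \<in> {1..m} \<Longrightarrow> R (v i) (v j) \<longleftrightarrow> j = Suc i"
    and "i \<in> {1..m}"
  shows "u i = v i"
proof -
  have "1 \<le> i" using assms by simp
  then show ?thesis using \<open>i \<in> {1..m}\<close>
  proof (induction i rule: dec_induct)
    case base
    then have "v 1 \<in> u ` {1..m}"
      unfolding img by (rule imageI)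
    then obtain k where k: "k \<in> {1..m}" "v 1 = u k"
      by blast
    show ?case
    proof (cases "k = 1")
      case False
      \<comment> \<open>If \<open>k\<close> exceeded 1, then \<open>v 1\<close> would have a
        predecessor \<open>u p\<close>, which is some \<open>v l\<close>; this gives
        \<open>1 = Suc l\<close> with \<open>l\<close> positive.\<close>
      then obtain p where p: "k = Suc p" "p \<in> {1..m}"
        using k(1) by (cases k) auto
      have "u p \<in> v ` {1..m}"
        using p(2) img by blast
      then obtain l where l: "l \<in> {1..m}" "u p = v l"
        by blast
      have "R (v l) (v 1)"
        using u[OF p(2) k(1)] p(1) k(2) l(2) by simp
      then show ?thesis
        using v[OF l(1) base] l(1) by simp
    qed (use k in simp)
  next
    case (step i)
    have "v (Suc i) \<in> u ` {1..m}"
      unfolding img using step.prems by (rule imageI)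
    then obtain k where k: "k \<in> {1..m}" "v (Suc i) = u k"
      by blast
    have i: "i \<in> {1..m}"
      using step.hyps step.prems by simp
    \<comment> \<open>Read along \<open>v\<close>, this is the arrow from \<open>v i\<close> to
      \<open>v (Suc i)\<close>; read along \<open>u\<close>, it forces
      \<open>k = Suc i\<close>.\<close>
    have "R (u i) (u k)"
      using v[OF i step.prems] step.IH[OF i] k(2) by simp
    then show ?case
      using u[OF i k(1)] k(2) by simp
  qed
qed

text \<open>A decoder sees only \<open>U\<close>, so a second source string \<open>y\<close> with
  its own error count must be allowed. The overlap relation mentions neither source, so both
  indexings trace the same path.\<close>

lemma indexed_relative_unique:
  assumes "1 \<le> L" "L \<le> length x" "length y = length x"
    and "substring_distant (L - 1) (4 * s + 1) x" "indexed_relative L t s x U u"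
    and "substring_distant (L - 1) (4 * s + 1) y" "indexed_relative L t' s y U v"
    and "i \<in> {1..length x - L + 1}"
  shows "u i = v i"
proof (rule path_enumeration_unique)
  show "u ` {1..length x - L + 1} = v ` {1..length x - L + 1}"
    using assms indexed_relative_set_mset by metis
next
  fix i j assume "i \<in> {1..length x - L + 1}" "j \<in> {1..length x - L + 1}"
  then show "hamming_dist (tl (u i)) (butlast (u j)) \<le> 2 * s \<longleftrightarrow> j = Suc i"
      "hamming_dist (tl (v i)) (butlast (v j)) \<le> 2 * s \<longleftrightarrow> j = Suc i"
    using assms overlap_iff_consecutive[of L x] overlap_iff_consecutive[of L y] by metis+
qed fact

lemma length_W2 [simp]: "length (W2 n L u) = n"
  by (simp add: W2_def)

lemma W2_cong:
  assumes "\<And>i. i \<in> {1..n - L + 1} \<Longrightarrow> u i = v i"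
  shows "W2 n L u = W2 n L v"
proof -
  \<comment> \<open>Finiteness turns membership in \<open>mset_set\<close> into plain set
    membership, which bounds \<open>i\<close>.\<close>
  have "finite {(i, k). (i, k) \<in> {1..n - L + 1} \<times> {1..L} \<and> i + k - 1 = j}" for j
    by (rule finite_subset[of _ "{1..n - L + 1} \<times> {1..L}"]) auto
  then show ?thesis
    unfolding W2_def using assms
    by (intro map_cong refl arg_cong[where f = maj] image_mset_cong) auto
qed

theorem theorem16:
  fixes n L s :: nat
  assumes "2 \<le> L" and "L \<le> n"
  shows "\<exists>Rec :: bool list multiset \<Rightarrow> bool list.
     (\<forall>U. (\<forall>u\<in>#U. length u = L) \<longrightarrow> length (Rec U) = n) \<and>
     (\<forall>x. length x = n \<and> substring_distant (L - 1) (4 * s + 1) x \<longrightarrow>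
        (\<forall>t\<in>{1..n}. \<forall>U\<in>erroneous_multispectra L t s x.
           \<forall>u. indexed_relative L t s x U u \<longrightarrow> Rec U = W2 n L u))"
proof -
  \<comment> \<open>Quantifying \<open>x\<close> and \<open>t\<close> away makes the choice below
    depend on \<open>n\<close>, \<open>L\<close>, \<open>s\<close> and \<open>U\<close>
    only.\<close>
  define P where "P U u \<longleftrightarrow> (\<exists>x t. length x = n \<and> substring_distant (L - 1) (4 * s + 1) x \<and>
    indexed_relative L t s x U u)" for U u
  have unique: "W2 n L v = W2 n L u" if v: "P U v" and u: "P U u" for U u v
  proof (rule W2_cong)
    fix i assume i: "i \<in> {1..n - L + 1}"
    obtain x t where x: "length x = n" "substring_distant (L - 1) (4 * s + 1) x"
        "indexed_relative L t s x U v"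
      using v unfolding P_def by blast
    obtain y t' where y: "length y = n" "substring_distant (L - 1) (4 * s + 1) y"
        "indexed_relative L t' s y U u"
      using u unfolding P_def by blast
    show "v i = u i"
      using indexed_relative_unique[OF _ _ _ x(2,3) y(2,3)] assms x(1) y(1) i by simp
  qed
  have "W2 n L (SOME v. P U v) = W2 n L u" if "P U u" for U u
    by (rule unique[OF someI[of "P U"] that]) (rule that)
  \<comment> \<open>When no indexing satisfies \<open>P U\<close>, the choice is arbitrary, but
    \<open>W2\<close> still returns a string of length \<open>n\<close>.\<close>
  then show ?thesis
    by (intro exI[of _ "\<lambda>U. W2 n L (SOME v. P U v)"]) (auto simp: P_def)
qed

end
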